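(* Let $\alpha\in[0,1)$. Suppose $f\in\mathcal{A}$, $f(z)=z+\sum_{n=2}^\infty a_nz^n$, satisfies $\sum_{n=2}^{\infty}n(n-1)|a_n|\leq \beta<1$. Then the following holds. (1) The function $f$ belongs to the class $\mathcal{C}_\alpha$ for $\beta\leq (1-\alpha)/(2-\alpha)$, and the bound $(1-\alpha)/(2-\alpha)$ cannot be replaced by a larger number (that is, for every $\beta'>(1-\alpha)/(2-\alpha)$ there is $f\in\mathcal{A}$ with $\sum_{n=2}^\infty n(n-1)|a_n|\le\beta'$ and $f\notin\mathcal{C}_\alpha$). (2) The function $f$ belongs to the class $\mathcal{S}^*_\alpha$ for $\beta\leq 2(1-\alpha)/(2-\alpha)$, and the bound $2(1-\alpha)/(2-\alpha)$ cannot be replaced by a larger number (that is, for every $\beta'>2(1-\alpha)/(2-\alpha)$ there is $f\in\mathcal{A}$ with $\sum_{n=2}^\infty n(n-1)|a_n|\le\beta'$ and $f\notin\mathcal{S}^*_\alpha$).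
   Context: $\mathbb{D}=\{z\in\mathbb{C}:|z|<1\}$. $\mathcal{A}$ is the class of analytic functions $f$ on $\mathbb{D}$ with $f(0)=0$, $f'(0)=1$, so $f(z)=z+\sum_{n=2}^\infty a_nz^n$. $\mathcal{S}\subset\mathcal{A}$ is the subclass of univalent functions. For $0\le\alpha<1$, $$\mathcal{S}^*_\alpha=\Big\{f\in\mathcal{S}:\Big|\frac{zf'(z)}{f(z)}-1\Big|<1-\alpha \text{ for all } z\in\mathbb{D}\Big\},\qquad \mathcal{C}_\alpha=\Big\{f\in\mathcal{S}:\Big|\frac{zf''(z)}{f'(z)}\Big|<1-\alpha\text{ for all } z\in\mathbb{D}\Big\},$$ where $zf'(z)/f(z)$ is given the value $1$ at $z=0$. *)

theory Defs
  imports "HOL-Complex_Analysis.Complex_Analysis"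
begin

text \<open>
  Functions on the open unit disc are represented by total functions on \<^typ>\<open>complex\<close>. Their values
  outside \<^term>\<open>ball 0 1\<close> are arbitrary and play no role, since \<^const>\<open>deriv\<close> at a point of the
  (open) disc depends only on values near that point.
\<close>

definition class_A :: "(complex \<Rightarrow> complex) set" where
  "class_A = {f. f holomorphic_on ball 0 1 \<and> f 0 = 0 \<and> deriv f 0 = 1}"

definition class_S :: "(complex \<Rightarrow> complex) set" where
  "class_S = {f \<in> class_A. inj_on f (ball 0 1)}"

text \<open>
  For \<^term>\<open>f \<in> class_S\<close> neither quotient below has a zero denominator on the disc, apart from the
  one at \<open>z = 0\<close> in the starlike class, where the quotient is given its limit value 1.
\<close>

definition starlike_class :: "real \<Rightarrow> (complex \<Rightarrow> complex) set" where
  "starlike_class \<alpha> = {f \<in> class_S. \<forall>z \<in> ball 0 1.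
     norm ((if z = 0 then 1 else z * deriv f z / f z) - 1) < 1 - \<alpha>}"

definition convex_class :: "real \<Rightarrow> (complex \<Rightarrow> complex) set" where
  "convex_class \<alpha> = {f \<in> class_S. \<forall>z \<in> ball 0 1.
     norm (z * deriv (deriv f) z / deriv f z) < 1 - \<alpha>}"

definition taylor_coeff :: "(complex \<Rightarrow> complex) \<Rightarrow> nat \<Rightarrow> complex" where
  "taylor_coeff f n = fps_nth (fps_expansion f 0) n"

text \<open>
  The inequality between the series and \<open>\<beta>\<close> includes convergence: \<^const>\<open>infsum\<close> of a family that
  is not summable is 0 by convention, so summability is required explicitly.
\<close>

definition coeff_sum_le :: "(complex \<Rightarrow> complex) \<Rightarrow> real \<Rightarrow> bool" where
  "coeff_sum_le f \<beta> \<longleftrightarrow>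
     (\<lambda>n. real n * (real n - 1) * norm (taylor_coeff f n)) summable_on {2..} \<and>
     (\<Sum>\<^sub>\<infinity>n\<in>{2..}. real n * (real n - 1) * norm (taylor_coeff f n)) \<le> \<beta>"

end

theory Submission
  imports Defs
begin

text \<open>
  With \<open>w\<^sub>n = n (n - 1) |a\<^sub>n|\<close>, each of \<open>z\<^sup>2 f''\<close>, \<open>z f' - z\<close>, \<open>2 (z f' - f)\<close> and \<open>2 (f - z)\<close> is a
  power series whose \<open>n\<close>-th coefficient is at most \<open>w\<^sub>n\<close> in modulus, hence is bounded by
  \<open>\<beta> |z|\<^sup>2\<close>. So both \<open>z f'' / f' = z\<^sup>2 f'' / (z f')\<close> and \<open>z f' / f - 1 = (z f' - f) / f\<close> have the
  form \<open>N / D\<close> with \<open>|N| \<le> b |z|\<^sup>2\<close> and \<open>|D - z| \<le> b |z|\<^sup>2\<close>, where \<open>b\<close> is \<open>\<beta>\<close> and \<open>\<beta> / 2\<close>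
  respectively. Univalence holds because \<open>f - id\<close> is a contraction. For both classes the extremal
  function is \<open>z - \<beta> z\<^sup>2 / 2\<close>.
\<close>

section \<open>Taylor series of f and of its derivatives on the disc\<close>

lemma taylor_coeff_deriv:
  "taylor_coeff (deriv f) n = of_nat (Suc n) * taylor_coeff f (Suc n)"
proof -
  have "(deriv ^^ n) (deriv f) = (deriv ^^ Suc n) f"
    by (simp add: funpow_Suc_right del: funpow.simps)
  then show ?thesis
    by (simp add: taylor_coeff_def fps_expansion_def field_simps del: of_nat_Suc)
qed

lemma taylor_sums:
  assumes "f holomorphic_on ball 0 1" "z \<in> ball 0 1"
  shows "(\<lambda>n. taylor_coeff f n * z ^ n) sums f z"
  using holomorphic_power_series[OF assms] by (simp add: taylor_coeff_def fps_expansion_def)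

lemma taylor_sums_deriv:
  assumes "f holomorphic_on ball 0 1" "z \<in> ball 0 1"
  shows "(\<lambda>n. of_nat n * taylor_coeff f n * z ^ n) sums (z * deriv f z)"
proof -
  have "(\<lambda>n. z * (taylor_coeff (deriv f) n * z ^ n)) sums (z * deriv f z)"
    using assms by (intro sums_mult taylor_sums holomorphic_deriv) auto
  then have "(\<lambda>n. of_nat (Suc n) * taylor_coeff f (Suc n) * z ^ Suc n) sums (z * deriv f z)"
    by (simp add: taylor_coeff_deriv algebra_simps)
  \<comment> \<open>The factor n kills the term at index 0, so undoing the index shift leaves the
    sum unchanged.\<close>
  then show ?thesis
    by (subst (asm) sums_Suc_iff) simp
qed

lemma taylor_sums_deriv2:
  assumes "f holomorphic_on ball 0 1" "z \<in> ball 0 1"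
  shows "(\<lambda>n. of_nat n * (of_nat n - 1) * taylor_coeff f n * z ^ n) sums (z\<^sup>2 * deriv (deriv f) z)"
proof -
  have "(\<lambda>n. z * (of_nat n * taylor_coeff (deriv f) n * z ^ n)) sums (z * (z * deriv (deriv f) z))"
    using assms by (intro sums_mult taylor_sums_deriv holomorphic_deriv) auto
  then have "(\<lambda>n. of_nat (Suc n) * (of_nat (Suc n) - 1) * taylor_coeff f (Suc n) * z ^ Suc n)
      sums (z\<^sup>2 * deriv (deriv f) z)"
    by (simp add: taylor_coeff_deriv algebra_simps power2_eq_square)
  then show ?thesis
    by (subst (asm) sums_Suc_iff) simp
qed

lemma taylor_coeff_class_A:
  assumes "f \<in> class_A"
  shows "taylor_coeff f 0 = 0" "taylor_coeff f 1 = 1"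
  using assms by (simp_all add: class_A_def taylor_coeff_def fps_expansion_def)

section \<open>The coefficient sum as a majorant for power series\<close>

lemma coeff_sum_le_sums:
  assumes "coeff_sum_le f \<beta>"
  obtains B where "(\<lambda>n. real n * (real n - 1) * norm (taylor_coeff f n)) sums B" "B \<le> \<beta>"
proof -
  let ?w = "\<lambda>n. real n * (real n - 1) * norm (taylor_coeff f n)"
  have "(?w has_sum infsum ?w {2..}) {2..}"
    using assms by (simp add: coeff_sum_le_def)
  \<comment> \<open>The weight n (n - 1) vanishes at n = 0 and n = 1, so the unordered sum over
    \<open>{2..}\<close> is one over all indices and hence an ordinary series.\<close>
  moreover have "(?w has_sum infsum ?w {2..}) {2..} \<longleftrightarrow> (?w has_sum infsum ?w {2..}) UNIV"
  proof (rule has_sum_cong_neutral)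
    fix n :: nat assume "n \<in> UNIV - {2..}"
    then have "n = 0 \<or> n = 1" by auto
    then show "?w n = 0" by auto
  qed auto
  ultimately have "?w sums infsum ?w {2..}"
    by (simp add: has_sum_imp_sums)
  with assms that show thesis
    by (simp add: coeff_sum_le_def)
qed

text \<open>Majorization term by term, using |z|^n \<le> |z|^2 for n \<ge> 2. The constant
  \<open>k\<close> carries a gain in the coefficient comparison (1/2 in two of the uses) over to the
  bound.\<close>

lemma norm_power_series_le:
  fixes c :: "nat \<Rightarrow> complex"
  assumes "coeff_sum_le f \<beta>" "norm z \<le> 1" "0 \<le> k" "(\<lambda>n. c n * z ^ n) sums s"
    and c: "\<And>n. norm (c n) \<le> k * (real n * (real n - 1) * norm (taylor_coeff f n))"
  shows "norm s \<le> k * \<beta> * (norm z)\<^sup>2"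
proof -
  let ?w = "\<lambda>n. real n * (real n - 1) * norm (taylor_coeff f n)"
  obtain B where B: "?w sums B" "B \<le> \<beta>"
    using assms(1) by (rule coeff_sum_le_sums)
  have le: "norm (c n * z ^ n) \<le> k * ?w n * (norm z)\<^sup>2" for n
  proof (cases "n \<ge> 2")
    case True
    then have "norm z ^ n \<le> norm z ^ 2"
      using assms(2) by (intro power_decreasing) auto
    then show ?thesis
      using c[of n] by (simp add: norm_mult norm_power mult_mono')
  next
    case False
    \<comment> \<open>For these n the right side of \<open>c\<close> is 0, which forces
      \<open>c n = 0\<close>; the series thus starts at z^2.\<close>
    then have "n = 0 \<or> n = 1" by auto
    then show ?thesis using c[of n] by auto
  qed
  have S: "(\<lambda>n. k * ?w n * (norm z)\<^sup>2) sums (k * B * (norm z)\<^sup>2)"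
    by (intro sums_mult sums_mult2 B)
  have "norm s = norm (\<Sum>n. c n * z ^ n)"
    using assms(4) by (simp add: sums_iff)
  also have "\<dots> \<le> (\<Sum>n. k * ?w n * (norm z)\<^sup>2)"
    by (rule norm_suminf_le[OF le]) (rule sums_summable[OF S])
  also have "\<dots> = k * B * (norm z)\<^sup>2"
    using S by (simp add: sums_iff)
  also have "\<dots> \<le> k * \<beta> * (norm z)\<^sup>2"
    using B(2) assms(3) by (intro mult_right_mono mult_left_mono) auto
  finally show ?thesis .
qed

section \<open>Estimates of order |z|^2 for f and its derivatives\<close>

context
  fixes f \<beta> z
  assumes f: "f \<in> class_A" and coeff: "coeff_sum_le f \<beta>" and z: "z \<in> ball (0 :: complex) 1"
begin

private lemma hol: "f holomorphic_on ball 0 1"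
  using f by (simp add: class_A_def)

text \<open>With z written as a power series it can be subtracted coefficientwise; as a_1 = 1, this
  removes the linear term of f and of z f'.\<close>

private lemma sums_id: "(\<lambda>n. of_bool (n = 1) * z ^ n) sums z"
proof -
  have "(\<lambda>n. of_bool (n = 1) * z ^ n) = (\<lambda>n. if n = 1 then z ^ n else 0)" by auto
  then show ?thesis using sums_single[of 1 "\<lambda>n. z ^ n"] by simp
qed

private lemma norm_z: "norm z \<le> 1"
  using z by simp

private lemma index_cases:
  fixes n :: nat
  obtains "n = 0" | "n = 1" | "n \<ge> 2"
  by linarith

lemma norm_deriv2_le: "norm (z\<^sup>2 * deriv (deriv f) z) \<le> \<beta> * (norm z)\<^sup>2"
proof -
  have "norm (of_nat n * (of_nat n - 1) * taylor_coeff f n)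
      \<le> 1 * (real n * (real n - 1) * norm (taylor_coeff f n))" for n
  \<comment> \<open>At n = 0 the norm of \<open>of_nat n - 1\<close> is 1 whereas
    \<open>real n - 1\<close> is -1, but the factor n makes both sides 0.\<close>
  proof (cases n)
    case (Suc m)
    then have "norm (of_nat n - 1 :: complex) = real n - 1" by simp
    then show ?thesis by (simp add: norm_mult)
  qed simp
  from norm_power_series_le[OF coeff norm_z _ taylor_sums_deriv2[OF hol z] this] show ?thesis
    by simp
qed

lemma norm_deriv_le: "norm (z * deriv f z - z) \<le> \<beta> * (norm z)\<^sup>2"
proof -
  have "(\<lambda>n. (of_nat n * taylor_coeff f n - of_bool (n = 1)) * z ^ n) sums (z * deriv f z - z)"
    using sums_diff[OF taylor_sums_deriv[OF hol z] sums_id] by (simp add: algebra_simps)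
  moreover have "norm (of_nat n * taylor_coeff f n - of_bool (n = 1))
      \<le> 1 * (real n * (real n - 1) * norm (taylor_coeff f n))" for n
  proof (cases n rule: index_cases)
    case 3
    then have "real n * 1 \<le> real n * (real n - 1)" by (intro mult_left_mono) auto
    from mult_right_mono[OF this norm_ge_zero[of "taylor_coeff f n"]] 3 show ?thesis by (simp add: norm_mult)
  qed (use taylor_coeff_class_A[OF f] in auto)
  ultimately show ?thesis
    using norm_power_series_le[OF coeff norm_z, of 1] by simp
qed

text \<open>For n \<ge> 2, n - 1 \<le> n (n - 1) / 2. This gain of 1/2, shared by
  \<open>norm_minus_le\<close>, makes the starlike bound twice the convex one.\<close>

lemma norm_deriv_minus_le: "norm (z * deriv f z - f z) \<le> \<beta> / 2 * (norm z)\<^sup>2"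
proof -
  have "(\<lambda>n. (of_nat n - 1) * taylor_coeff f n * z ^ n) sums (z * deriv f z - f z)"
    using sums_diff[OF taylor_sums_deriv[OF hol z] taylor_sums[OF hol z]]
    by (simp add: algebra_simps)
  moreover have "norm ((of_nat n - 1) * taylor_coeff f n)
      \<le> 1 / 2 * (real n * (real n - 1) * norm (taylor_coeff f n))" for n
  proof (cases n rule: index_cases)
    case 3
    then have eq: "norm (of_nat n - 1 :: complex) = real n - 1"
      using norm_of_real[of "real n - 1", where 'a = complex] by simp
    have "2 * (real n - 1) \<le> real n * (real n - 1)"
      using 3 by (intro mult_right_mono) auto
    from mult_right_mono[OF this norm_ge_zero[of "taylor_coeff f n"]] show ?thesis
      unfolding norm_mult eq by linarith
  qed (use taylor_coeff_class_A[OF f] in auto)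
  ultimately show ?thesis
    using norm_power_series_le[OF coeff norm_z, of "1 / 2"] by simp
qed

lemma norm_minus_le: "norm (f z - z) \<le> \<beta> / 2 * (norm z)\<^sup>2"
proof -
  have "(\<lambda>n. (taylor_coeff f n - of_bool (n = 1)) * z ^ n) sums (f z - z)"
    using sums_diff[OF taylor_sums[OF hol z] sums_id] by (simp add: algebra_simps)
  moreover have "norm (taylor_coeff f n - of_bool (n = 1))
      \<le> 1 / 2 * (real n * (real n - 1) * norm (taylor_coeff f n))" for n
  proof (cases n rule: index_cases)
    case 3
    then have "2 * 1 \<le> real n * (real n - 1)" by (intro mult_mono) auto
    from mult_right_mono[OF this norm_ge_zero[of "taylor_coeff f n"]] 3 show ?thesis by simp
  qed (use taylor_coeff_class_A[OF f] in auto)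
  ultimately show ?thesis
    using norm_power_series_le[OF coeff norm_z, of "1 / 2"] by simp
qed

end

section \<open>Univalence for \<beta> < 1\<close>

lemma coeff_sum_le_nonneg:
  assumes "coeff_sum_le f \<beta>"
  shows "0 \<le> \<beta>"
proof -
  have "0 \<le> (\<Sum>\<^sub>\<infinity>n\<in>{2..}. real n * (real n - 1) * norm (taylor_coeff f n))"
    by (intro infsum_nonneg) auto
  with assms show ?thesis by (simp add: coeff_sum_le_def)
qed

lemma coeff_sum_le_imp_class_S:
  assumes "f \<in> class_A" "coeff_sum_le f \<beta>" "\<beta> < 1"
  shows "f \<in> class_S"
proof -
  have hol: "f holomorphic_on ball 0 1"
    using assms(1) by (simp add: class_A_def)
  have bound: "norm (deriv f z - 1) \<le> \<beta>" if z: "z \<in> ball 0 1" for z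
  proof (cases "z = 0")
    case True
    then show ?thesis
      using assms(1) coeff_sum_le_nonneg[OF assms(2)] by (simp add: class_A_def)
  next
    case False
    \<comment> \<open>Cancelling one factor |z| in \<open>norm_deriv_le\<close> gives |f' - 1| \<le>
      \<beta> |z|; the origin, where nothing can be cancelled, is covered by f'(0) = 1.\<close>
    have "norm z * norm (deriv f z - 1) = norm (z * deriv f z - z)"
      by (simp add: right_diff_distrib flip: norm_mult)
    also have "\<dots> \<le> norm z * (\<beta> * norm z)"
      using norm_deriv_le[OF assms(1,2) z] by (simp add: power2_eq_square mult_ac)
    finally have "norm (deriv f z - 1) \<le> \<beta> * norm z"
      using False by simp
    also have "\<dots> \<le> \<beta> * 1"
      using z coeff_sum_le_nonneg[OF assms(2)] by (intro mult_left_mono) auto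
    finally show ?thesis by simp
  qed
  have "x = y" if xy: "x \<in> ball 0 1" "y \<in> ball 0 1" "f x = f y" for x y
  proof (rule ccontr)
    assume "x \<noteq> y"
    have "((\<lambda>z. f z - z) has_field_derivative (deriv f z - 1)) (at z within ball 0 1)"
      if "z \<in> ball 0 1" for z
      by (rule has_field_derivative_at_within, intro DERIV_diff DERIV_ident)
        (rule holomorphic_derivI[OF hol open_ball that])
    \<comment> \<open>On the convex disc the derivative bound makes f - id Lipschitz with constant
      \<beta>; if f x = f y, its values at x and y differ by |x - y| in norm.\<close>
    from field_differentiable_bound[OF convex_ball this bound xy(1,2)]
    have "norm ((f x - x) - (f y - y)) \<le> \<beta> * norm (x - y)"
      by simp
    then have "1 * norm (x - y) \<le> \<beta> * norm (x - y)"
      using xy(3) by (simp add: norm_minus_commute)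
    with \<open>x \<noteq> y\<close> assms(3) show False
      by (subst (asm) mult_le_cancel_right) auto
  qed
  then show ?thesis
    using assms(1) by (auto simp: class_S_def inj_on_def)
qed

section \<open>Membership in the two classes\<close>

text \<open>Put r = |z|. Then |D| \<ge> r - b r^2, so |N / D| is at most b r / (1 - b r), and this
  is below 1 - \<alpha> once b r < (1 - \<alpha>) / (2 - \<alpha>). Strictness comes from r < 1, or
  from b = 0.\<close>

lemma norm_divide_less:
  fixes N D z :: complex
  assumes "norm N \<le> b * (norm z)\<^sup>2" "norm (D - z) \<le> b * (norm z)\<^sup>2"
    and z: "z \<noteq> 0" "norm z < 1" and "\<alpha> < 1" "0 \<le> b" and b: "b \<le> (1 - \<alpha>) / (2 - \<alpha>)"
  shows "D \<noteq> 0" "norm (N / D) < 1 - \<alpha>"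
proof -
  let ?r = "norm z"
  have "b * ?r < (1 - \<alpha>) / (2 - \<alpha>)"
  proof (cases "b = 0")
    case False
    with assms have "b * ?r < b * 1" by (intro mult_strict_left_mono) auto
    with b show ?thesis by simp
  qed (use assms in simp)
  then have br: "b * ?r * (2 - \<alpha>) < 1 - \<alpha>"
    using assms by (simp add: pos_less_divide_eq)
  then have "b * ?r < (1 - \<alpha>) * (1 - b * ?r)"
    by (simp add: algebra_simps)
  then have "b * ?r * ?r < (1 - \<alpha>) * (1 - b * ?r) * ?r"
    using z by (intro mult_strict_right_mono) auto
  then have *: "b * ?r\<^sup>2 < (1 - \<alpha>) * (?r - b * ?r\<^sup>2)"
    by (simp add: power2_eq_square algebra_simps)
  also have "?r - b * ?r\<^sup>2 \<le> norm D"
    using norm_triangle_ineq2[of z "z - D"] assms(2) by (simp add: norm_minus_commute)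
  finally have **: "b * ?r\<^sup>2 < (1 - \<alpha>) * norm D"
    using assms by simp
  \<comment> \<open>A nonnegative number lies strictly below (1 - \<alpha>) |D|, which excludes D =
    0.\<close>
  moreover have "0 \<le> b * ?r\<^sup>2" using assms by simp
  ultimately show D: "D \<noteq> 0" by auto
  have "norm N < (1 - \<alpha>) * norm D"
    using assms(1) ** by linarith
  then show "norm (N / D) < 1 - \<alpha>"
    using D by (simp add: norm_divide pos_divide_less_eq)
qed

lemma coeff_sum_le_imp_convex_class:
  assumes "f \<in> class_A" "coeff_sum_le f \<beta>" "\<beta> < 1" "\<alpha> < 1" "\<beta> \<le> (1 - \<alpha>) / (2 - \<alpha>)"
  shows "f \<in> convex_class \<alpha>"
proof -
  have "norm (z * deriv (deriv f) z / deriv f z) < 1 - \<alpha>" if z: "z \<in> ball 0 1" for z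
  proof (cases "z = 0")
    case False
    \<comment> \<open>Extending the fraction by z gives a denominator z f' that is close to
      z.\<close>
    have "norm (z\<^sup>2 * deriv (deriv f) z / (z * deriv f z)) < 1 - \<alpha>"
      using z False assms
      by (intro norm_divide_less(2)[OF norm_deriv2_le norm_deriv_le] coeff_sum_le_nonneg) auto
    also have "z\<^sup>2 * deriv (deriv f) z / (z * deriv f z) = z * deriv (deriv f) z / deriv f z"
      using False by (simp add: power2_eq_square)
    finally show ?thesis .
  qed (use assms in simp)
  then show ?thesis
    using coeff_sum_le_imp_class_S[OF assms(1-3)] by (simp add: convex_class_def)
qed

lemma coeff_sum_le_imp_starlike_class:
  assumes "f \<in> class_A" "coeff_sum_le f \<beta>" "\<beta> < 1" "\<alpha> < 1" "\<beta> \<le> 2 * (1 - \<alpha>) / (2 - \<alpha>)"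
  shows "f \<in> starlike_class \<alpha>"
proof -
  have "norm ((if z = 0 then 1 else z * deriv f z / f z) - 1) < 1 - \<alpha>" if z: "z \<in> ball 0 1" for z
  proof (cases "z = 0")
    case False
    \<comment> \<open>Numerator and denominator both satisfy their estimates with \<beta> / 2, so
      only \<beta> / 2 has to stay within (1 - \<alpha>) / (2 - \<alpha>).\<close>
    have b: "0 \<le> \<beta> / 2" "\<beta> / 2 \<le> (1 - \<alpha>) / (2 - \<alpha>)"
      using assms(5) coeff_sum_le_nonneg[OF assms(2)] by (simp_all add: mult.commute)
    have "norm z < 1" using z by simp
    note * = norm_divide_less[OF norm_deriv_minus_le[OF assms(1,2) z]
        norm_minus_le[OF assms(1,2) z] False this assms(4) b]
    then show ?thesis
      using False by (simp add: diff_divide_distrib)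
  qed (use assms in simp)
  then show ?thesis
    using coeff_sum_le_imp_class_S[OF assms(1-3)] by (simp add: starlike_class_def)
qed

section \<open>Sharpness of the bounds\<close>

text \<open>The coefficient -\<beta> / 2 makes the only nonzero term of the sum, 2 |a_2|, equal to
  \<beta> when \<beta> \<ge> 0.\<close>

definition extremal :: "real \<Rightarrow> complex \<Rightarrow> complex" where
  "extremal \<beta> z = z - of_real (\<beta> / 2) * z\<^sup>2"

lemma deriv_extremal: "deriv (extremal \<beta>) = (\<lambda>z. 1 - of_real \<beta> * z)"
proof
  fix z
  show "deriv (extremal \<beta>) z = 1 - of_real \<beta> * z"
    unfolding extremal_def by (rule DERIV_imp_deriv) (auto intro!: derivative_eq_intros)
qed

lemma deriv_deriv_extremal: "deriv (deriv (extremal \<beta>)) z = - of_real \<beta>"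
  unfolding deriv_extremal by (rule DERIV_imp_deriv) (auto intro!: derivative_eq_intros)

lemma extremal_class_A: "extremal \<beta> \<in> class_A"
proof -
  have "extremal \<beta> holomorphic_on ball 0 1"
    unfolding extremal_def by (intro holomorphic_intros)
  then show ?thesis
    by (simp add: class_A_def deriv_extremal) (simp add: extremal_def)
qed

lemma taylor_coeff_extremal:
  assumes "n \<ge> 2"
  shows "taylor_coeff (extremal \<beta>) n = (if n = 2 then - of_real (\<beta> / 2) else 0)"
proof -
  have "extremal \<beta> has_fps_expansion fps_X - fps_const (of_real (\<beta> / 2)) * fps_X ^ 2"
    unfolding extremal_def by (intro fps_expansion_intros)
  then have "fps_expansion (extremal \<beta>) 0 = fps_X - fps_const (of_real (\<beta> / 2)) * fps_X ^ 2"
    by (rule fps_expansion_eqI)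
  then show ?thesis
    using assms by (auto simp: taylor_coeff_def)
qed

lemma coeff_sum_le_extremal:
  assumes "0 \<le> \<beta>"
  shows "coeff_sum_le (extremal \<beta>) \<beta>"
proof -
  let ?w = "\<lambda>n. real n * (real n - 1) * norm (taylor_coeff (extremal \<beta>) n)"
  have "(?w has_sum (\<Sum>n\<in>{2}. ?w n)) {2}"
    by (rule has_sum_finite) simp
  moreover have "(\<Sum>n\<in>{2}. ?w n) = \<beta>"
    using assms by (simp add: taylor_coeff_extremal)
  moreover have "(?w has_sum \<beta>) {2} \<longleftrightarrow> (?w has_sum \<beta>) {2..}"
    by (rule has_sum_cong_neutral) (auto simp: taylor_coeff_extremal)
  ultimately have "(?w has_sum \<beta>) {2..}" by metis
  then show ?thesis
    by (auto simp: coeff_sum_le_def summable_on_def infsumI)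
qed

text \<open>The witness is z = q / \<beta>, in the disc because q < \<beta>. There z f'' / f' = -q /
  (1 - q), and q solves t / (1 - t) = 1 - \<alpha>, so equality holds where the class demands strict
  inequality.\<close>

lemma extremal_not_convex:
  assumes "\<alpha> < 1" "(1 - \<alpha>) / (2 - \<alpha>) < \<beta>"
  shows "extremal \<beta> \<notin> convex_class \<alpha>"
proof
  assume C: "extremal \<beta> \<in> convex_class \<alpha>"
  define q where "q = (1 - \<alpha>) / (2 - \<alpha>)"
  have q: "0 < q" "q < \<beta>" using assms by (auto simp: q_def)
  have "q / (1 - q) = 1 - \<alpha>" using assms by (simp add: q_def field_simps)
  moreover have "1 - q > 0" using assms by (simp add: q_def field_simps)
  moreover have "complex_of_real (q / \<beta>) \<in> ball 0 1"
    using q by (simp add: norm_divide)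
  with C have "norm (of_real (q / \<beta>) * - of_real \<beta> / (1 - of_real \<beta> * of_real (q / \<beta>)) :: complex)
      < 1 - \<alpha>"
    unfolding convex_class_def mem_Collect_eq deriv_deriv_extremal
    by (auto simp only: deriv_extremal)
  moreover have "of_real (q / \<beta>) * - of_real \<beta> / (1 - of_real \<beta> * of_real (q / \<beta>))
      = complex_of_real (- (q / (1 - q)))"
    using q by simp
  ultimately show False
    using q by (simp only: norm_of_real)
qed

text \<open>Since z f' / f - 1 = -(\<beta> z / 2) / (1 - \<beta> z / 2), the critical value -q / (1
  - q) is attained where \<beta> z = 2 q, a point of the disc because 2 q < \<beta>.\<close>

lemma extremal_not_starlike:
  assumes "\<alpha> < 1" "2 * (1 - \<alpha>) / (2 - \<alpha>) < \<beta>"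
  shows "extremal \<beta> \<notin> starlike_class \<alpha>"
proof
  assume C: "extremal \<beta> \<in> starlike_class \<alpha>"
  define q where "q = (1 - \<alpha>) / (2 - \<alpha>)"
  have q: "0 < q" "2 * q < \<beta>" using assms by (auto simp: q_def)
  define x where "x = 2 * q / \<beta>"
  have x: "0 < x" "x < 1" "\<beta> * x = 2 * q" using q by (auto simp: x_def)
  have "q / (1 - q) = 1 - \<alpha>" using assms by (simp add: q_def field_simps)
  moreover have q1: "1 - q > 0" using assms by (simp add: q_def field_simps)
  moreover have "complex_of_real x \<in> ball 0 1" "complex_of_real x \<noteq> 0"
    using x by auto
  with C have "norm (of_real x * deriv (extremal \<beta>) (of_real x) / extremal \<beta> (of_real x) - 1) < 1 - \<alpha>"
    unfolding starlike_class_def by fastforce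
  moreover have "of_real x * deriv (extremal \<beta>) (of_real x) / extremal \<beta> (of_real x) - 1
      = complex_of_real (- (q / (1 - q)))"
  proof -
    have "extremal \<beta> (of_real x) = of_real (x * (1 - \<beta> * x / 2))"
      by (simp add: extremal_def power2_eq_square algebra_simps)
    then have "of_real x * deriv (extremal \<beta>) (of_real x) / extremal \<beta> (of_real x) - 1
        = of_real (x * (1 - \<beta> * x) / (x * (1 - \<beta> * x / 2)) - 1)"
      by (simp add: deriv_extremal)
    also have "x * (1 - \<beta> * x) / (x * (1 - \<beta> * x / 2)) - 1 = - (q / (1 - q))"
      using x q1 by (simp add: field_simps)
    finally show ?thesis .
  qed
  ultimately show False
    using q by (simp only: norm_of_real)
qed

theorem theorem2p1:
  fixes \<alpha> :: real
  assumes "0 \<le> \<alpha>" and "\<alpha> < 1"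
  shows
    "(\<forall>f \<beta>. f \<in> class_A \<and> coeff_sum_le f \<beta> \<and> \<beta> < 1 \<and> \<beta> \<le> (1 - \<alpha>) / (2 - \<alpha>)
        \<longrightarrow> f \<in> convex_class \<alpha>) \<and>
     (\<forall>\<beta>' > (1 - \<alpha>) / (2 - \<alpha>). \<exists>f \<in> class_A. coeff_sum_le f \<beta>' \<and> f \<notin> convex_class \<alpha>) \<and>
     (\<forall>f \<beta>. f \<in> class_A \<and> coeff_sum_le f \<beta> \<and> \<beta> < 1 \<and> \<beta> \<le> 2 * (1 - \<alpha>) / (2 - \<alpha>)
        \<longrightarrow> f \<in> starlike_class \<alpha>) \<and>
     (\<forall>\<beta>' > 2 * (1 - \<alpha>) / (2 - \<alpha>). \<exists>f \<in> class_A. coeff_sum_le f \<beta>' \<and> f \<notin> starlike_class \<alpha>)"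
proof (intro conjI allI impI)
  show "\<exists>f\<in>class_A. coeff_sum_le f \<beta>' \<and> f \<notin> convex_class \<alpha>" if "(1 - \<alpha>) / (2 - \<alpha>) < \<beta>'" for \<beta>'
  proof (intro bexI conjI)
    \<comment> \<open>Positivity of the threshold makes \<beta>' nonnegative, so the coefficient sum
      of the extremal function is \<beta>' itself.\<close>
    have "0 < (1 - \<alpha>) / (2 - \<alpha>)" using assms by simp
    with that show "coeff_sum_le (extremal \<beta>') \<beta>'" by (intro coeff_sum_le_extremal) linarith
  qed (rule extremal_not_convex[OF assms(2) that] extremal_class_A)+
  show "\<exists>f\<in>class_A. coeff_sum_le f \<beta>' \<and> f \<notin> starlike_class \<alpha>"
    if "2 * (1 - \<alpha>) / (2 - \<alpha>) < \<beta>'" for \<beta>'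
  proof (intro bexI conjI)
    have "0 < 2 * (1 - \<alpha>) / (2 - \<alpha>)" using assms by simp
    with that show "coeff_sum_le (extremal \<beta>') \<beta>'" by (intro coeff_sum_le_extremal) linarith
  qed (rule extremal_not_starlike[OF assms(2) that] extremal_class_A)+
qed (use assms coeff_sum_le_imp_convex_class coeff_sum_le_imp_starlike_class in blast)+

end
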